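(* There exists a two-player win-lose game with infinite past with action set $A=\{0,1\}$, in which player 1's winning set $W\subseteq R$ belongs to the Borel class $\Delta_3$ (with respect to the product topology on $R$), and which admits no equilibrium, and hence no strong equilibrium either.
   Context: Let $\mathbb{Z}_0=\{\ldots,-2,-1,0\}$ and, for $n\in\mathbb{Z}_0$, $\mathbb{Z}_n=\{\ldots,n-1,n\}$. Let $A$ be a finite action set with $|A|\ge 2$. A position in stage $n\in\mathbb{Z}_0$ is a sequence $p_n=(\ldots,a_{n-2},a_{n-1})\in P_n:=A^{\mathbb{Z}_{n-1}}$, and $P=\bigcup_{n\in\mathbb{Z}_0}P_n$ (a disjoint union). A run is a sequence $r=(\ldots,a_{-1},a_0)\in R:=A^{\mathbb{Z}_0}$; $r_{<n}=(\ldots,a_{n-2},a_{n-1})$ is the position in stage $n$ along $r$. $R$ carries the product topology, with $A$ discrete. Borel classes on $R$: $\Sigma_1$ = open sets, $\Pi_1$ = closed sets; $\Sigma_{k+1}$ = countable unions of $\Pi_k$ sets, $\Pi_{k+1}$ = complements of $\Sigma_{k+1}$ sets; $\Delta_3=\Sigma_3\cap\Pi_3$. Two-player win-lose game with infinite past: players $I=\{1,2\}$; player 1 is active at (controls) all positions in even stages, player 2 at all positions in odd stages; there is a set $W\subseteq R$, the winning set of player 1, such that the payoffs are $u_1(r)=1,u_2(r)=0$ if $r\in W$ and $u_1(r)=0,u_2(r)=1$ if $r\in R\setminus W$. A strategy of player $i$ is a map $s_i$ from the set of positions player $i$ controls to $A$; a strategy profile is $s=(s_1,s_2)$. A run $r=(\ldots,a_{-1},a_0)$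 is consistent with $s_i$ if $a_n=s_i(r_{<n})$ for every stage $n\in\mathbb{Z}_0$ in which player $i$ is active; it is consistent with $s$ if it is consistent with both $s_1$ and $s_2$. $R(s)$ is the set of runs consistent with $s$. For a position $p_n\in P_n$, the subgame $G[p_n]$ is the finite game played in stages $n,\ldots,-1,0$ that arises when the actions up to stage $n-1$ are given by $p_n$; a strategy profile $s$ induces a strategy profile $s[p_n]$ in it. A traditional equilibrium of $G[p_n]$ is a pure Nash equilibrium of this finite game. Equilibrium: a pair $(s,r)$, with $s$ a strategy profile and $r\in R(s)$, such that for each $n\in\mathbb{Z}_0$, $s[r_{<n}]$ is a traditional equilibrium of $G[r_{<n}]$. Strong equilibrium: a strategy profile $s$ with $R(s)=\{r\}$ for some run $r$ such that for each player $i$, each strategy $s'_i$ of player $i$ and each run $r'$ consistent with the profile in which player $i$ plays $s'_i$ and the other player plays according to $s$, we have $u_i(r')\le u_i(r)$. *)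

theory Defs
  imports "HOL-Analysis.Analysis"
begin

text \<open>
  Levels are counted from 1; level 0 is a dummy and contains no set.
\<close>

fun borel_Sigma :: "'a topology \<Rightarrow> nat \<Rightarrow> 'a set set"
  and borel_Pi :: "'a topology \<Rightarrow> nat \<Rightarrow> 'a set set"
  where
    "borel_Sigma X 0 = {}"
  | "borel_Sigma X (Suc 0) = {S. openin X S}"
  | "borel_Sigma X (Suc (Suc k)) =
       {\<Union>\<C> | \<C>. countable \<C> \<and> \<C> \<subseteq> borel_Pi X (Suc k)}"
  | "borel_Pi X 0 = {}"
  | "borel_Pi X (Suc 0) = {S. closedin X S}"
  | "borel_Pi X (Suc (Suc k)) = {topspace X - S | S. S \<in> borel_Sigma X (Suc (Suc k))}"

definition borel_Delta :: "'a topology \<Rightarrow> nat \<Rightarrow> 'a set set" where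
  "borel_Delta X k = borel_Sigma X k \<inter> borel_Pi X k"

text \<open>
  Stages are the integers \<open>n \<le> 0\<close>. A sequence of actions indexed by a set of stages is an
  extensional function on that set, so that the topology on runs is the library's product topology.
  A position carries its stage explicitly: extensional functions on different domains may coincide
  (if \<^term>\<open>undefined\<close> is an action), whereas the sets of positions in different stages have to
  be disjoint.
\<close>

type_synonym 'a run = "int \<Rightarrow> 'a"
type_synonym 'a position = "int \<times> (int \<Rightarrow> 'a)"
type_synonym 'a strategy = "'a position \<Rightarrow> 'a"

datatype player = Player1 | Player2

type_synonym 'a profile = "player \<Rightarrow> 'a strategy"

definition runs :: "'a set \<Rightarrow> 'a run set" where
  "runs A = {..0} \<rightarrow>\<^sub>E A"

definition run_topology :: "'a set \<Rightarrow> 'a run topology" where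
  "run_topology A = product_topology (\<lambda>_. discrete_topology A) {..0}"

lemma topspace_run_topology: "topspace (run_topology A) = runs A"
  by (simp add: run_topology_def runs_def)

definition positions :: "'a set \<Rightarrow> 'a position set" where
  "positions A = (SIGMA n:{..0}. {..n - 1} \<rightarrow>\<^sub>E A)"

definition position_along :: "'a run \<Rightarrow> int \<Rightarrow> 'a position" where
  "position_along r n = (n, restrict r {..n - 1})"

definition active :: "int \<Rightarrow> player" where
  "active n = (if even n then Player1 else Player2)"

definition controlled :: "'a set \<Rightarrow> player \<Rightarrow> 'a position set" where
  "controlled A i = {p \<in> positions A. active (fst p) = i}"

definition strategies :: "'a set \<Rightarrow> player \<Rightarrow> 'a strategy set" where
  "strategies A i = controlled A i \<rightarrow>\<^sub>E A"

definition profiles :: "'a set \<Rightarrow> 'a profile set" where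
  "profiles A = {s. \<forall>i. s i \<in> strategies A i}"

definition consistent_with :: "player \<Rightarrow> 'a strategy \<Rightarrow> 'a run \<Rightarrow> bool" where
  "consistent_with i t r \<longleftrightarrow> (\<forall>n\<le>0. active n = i \<longrightarrow> r n = t (position_along r n))"

definition consistent_runs :: "'a set \<Rightarrow> 'a profile \<Rightarrow> 'a run set" where
  "consistent_runs A s = {r \<in> runs A. \<forall>i. consistent_with i (s i) r}"

text \<open>
  The only data of a two-player win-lose game are the action set \<open>A\<close> and the winning set
  \<open>W\<close> of player 1.
\<close>

definition win_lose_game :: "'a set \<Rightarrow> 'a run set \<Rightarrow> bool" where
  "win_lose_game A W \<longleftrightarrow> finite A \<and> card A \<ge> 2 \<and> W \<subseteq> runs A"

fun payoff :: "'a run set \<Rightarrow> player \<Rightarrow> 'a run \<Rightarrow> real" where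
  "payoff W Player1 r = (if r \<in> W then 1 else 0)"
| "payoff W Player2 r = (if r \<in> W then 0 else 1)"

text \<open>
  The subgame at a position \<open>p\<close> in stage \<open>n\<close> is the game tree rooted at \<open>p\<close>: its positions are the
  positions extending \<open>p\<close> (in stages \<open>n, \<dots>, 0\<close>), its plays are the runs passing through \<open>p\<close>, and
  a profile induces a profile of the subgame by restriction.
\<close>

definition subgame_positions :: "'a set \<Rightarrow> 'a position \<Rightarrow> 'a position set" where
  "subgame_positions A p =
     {q \<in> positions A. fst p \<le> fst q \<and> restrict (snd q) {..fst p - 1} = snd p}"

definition subgame_strategies :: "'a set \<Rightarrow> 'a position \<Rightarrow> player \<Rightarrow> 'a strategy set" where
  "subgame_strategies A p i = (controlled A i \<inter> subgame_positions A p) \<rightarrow>\<^sub>E A"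

definition subgame_profiles :: "'a set \<Rightarrow> 'a position \<Rightarrow> 'a profile set" where
  "subgame_profiles A p = {t. \<forall>i. t i \<in> subgame_strategies A p i}"

definition induced_profile :: "'a set \<Rightarrow> 'a profile \<Rightarrow> 'a position \<Rightarrow> 'a profile" where
  "induced_profile A s p =
     (\<lambda>i. restrict (s i) (controlled A i \<inter> subgame_positions A p))"

definition subgame_play :: "'a set \<Rightarrow> 'a position \<Rightarrow> 'a profile \<Rightarrow> 'a run \<Rightarrow> bool" where
  "subgame_play A p t r \<longleftrightarrow>
     r \<in> runs A \<and> position_along r (fst p) = p \<and>
     (\<forall>m\<in>{fst p..0}. r m = t (active m) (position_along r m))"

definition subgame_outcome :: "'a set \<Rightarrow> 'a position \<Rightarrow> 'a profile \<Rightarrow> 'a run" where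
  "subgame_outcome A p t = (THE r. subgame_play A p t r)"

definition traditional_equilibrium ::
    "'a set \<Rightarrow> 'a run set \<Rightarrow> 'a position \<Rightarrow> 'a profile \<Rightarrow> bool" where
  "traditional_equilibrium A W p t \<longleftrightarrow>
     t \<in> subgame_profiles A p \<and>
     (\<forall>i. \<forall>t'\<in>subgame_strategies A p i.
        payoff W i (subgame_outcome A p (t(i := t'))) \<le> payoff W i (subgame_outcome A p t))"

definition equilibrium :: "'a set \<Rightarrow> 'a run set \<Rightarrow> 'a profile \<Rightarrow> 'a run \<Rightarrow> bool" where
  "equilibrium A W s r \<longleftrightarrow>
     s \<in> profiles A \<and> r \<in> consistent_runs A s \<and>
     (\<forall>n\<le>0. traditional_equilibrium A W (position_along r n)
                (induced_profile A s (position_along r n)))"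

definition strong_equilibrium :: "'a set \<Rightarrow> 'a run set \<Rightarrow> 'a profile \<Rightarrow> bool" where
  "strong_equilibrium A W s \<longleftrightarrow>
     s \<in> profiles A \<and>
     (\<exists>r. consistent_runs A s = {r} \<and>
        (\<forall>i. \<forall>s'\<in>strategies A i. \<forall>r'\<in>consistent_runs A (s(i := s')).
           payoff W i r' \<le> payoff W i r))"

text \<open>
  The following lemmas show that the definite description in \<^const>\<open>subgame_outcome\<close> denotes
  the unique play of the subgame.
\<close>

lemma subgame_play_unique:
  assumes "subgame_play A p t r" "subgame_play A p t r'"
  shows "r = r'"
proof -
  obtain n q where p: "p = (n, q)" by fastforce
  have r: "r \<in> runs A" "restrict r {..n - 1} = q"
      "\<And>m. n \<le> m \<Longrightarrow> m \<le> 0 \<Longrightarrow> r m = t (active m) (position_along r m)"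
    using assms(1) by (auto simp: subgame_play_def p position_along_def)
  have r': "r' \<in> runs A" "restrict r' {..n - 1} = q"
      "\<And>m. n \<le> m \<Longrightarrow> m \<le> 0 \<Longrightarrow> r' m = t (active m) (position_along r' m)"
    using assms(2) by (auto simp: subgame_play_def p position_along_def)
  have low: "r m = r' m" if "m < n" for m
  proof -
    have "restrict r {..n - 1} m = restrict r' {..n - 1} m" using r(2) r'(2) by simp
    then show ?thesis using that by (simp add: restrict_def)
  qed
  have "\<forall>m < n + int k. m \<le> 0 \<longrightarrow> r m = r' m" for k
  proof (induction k)
    case 0
    then show ?case using low by simp
  next
    case (Suc k)
    show ?case
    proof (intro allI impI)
      fix m assume m: "m < n + int (Suc k)" "m \<le> 0"
      show "r m = r' m"
      proof (cases "m < n + int k")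
        case True
        then show ?thesis using Suc m by blast
      next
        case False
        then have "restrict r {..m - 1} = restrict r' {..m - 1}"
          using Suc m by (intro restrict_ext) auto
        then have "position_along r m = position_along r' m"
          by (simp add: position_along_def)
        moreover have "n \<le> m" using False by simp
        ultimately show ?thesis using r(3) r'(3) m(2) by metis
      qed
    qed
  qed
  from this[of "nat (1 - n)"] have "r m = r' m" if "m \<le> 0" for m
    using that by auto
  then show ?thesis
    using r(1) r'(1) unfolding runs_def by (intro PiE_ext[of r _ "\<lambda>_. A"]) auto
qed

lemma subgame_play_exists:
  assumes "p \<in> positions A" "t \<in> subgame_profiles A p"
  shows "\<exists>r. subgame_play A p t r"
proof -
  obtain n q where p: "p = (n, q)" by fastforce
  have n: "n \<le> 0" and q: "q \<in> {..n - 1} \<rightarrow>\<^sub>E A"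
    using assms(1) by (auto simp: positions_def p)
  have "\<exists>r. r \<in> {..n + int k - 1} \<rightarrow>\<^sub>E A \<and> restrict r {..n - 1} = q \<and>
          (\<forall>m\<in>{n..n + int k - 1}. r m = t (active m) (position_along r m))"
    if "n + int k \<le> 1" for k
    using that
  proof (induction k)
    case 0
    then show ?case using q by (intro exI[of _ q]) (simp add: PiE_restrict)
  next
    case (Suc k)
    define N where "N = n + int k"
    have "n + int k \<le> 1" using Suc.prems by simp
    from Suc.IH[OF this] obtain r where
        r: "r \<in> {..N - 1} \<rightarrow>\<^sub>E A" "restrict r {..n - 1} = q"
        "\<And>m. m \<in> {n..N - 1} \<Longrightarrow> r m = t (active m) (position_along r m)"
      unfolding N_def by blast
    have N: "n \<le> N" "N \<le> 0" using Suc.prems by (auto simp: N_def)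
    define a where "a = t (active N) (N, r)"
    have "(N, r) \<in> controlled A (active N) \<inter> subgame_positions A p"
      using r(1,2) N by (simp add: controlled_def positions_def subgame_positions_def p)
    moreover have "t (active N) \<in> subgame_strategies A p (active N)"
      using assms(2) by (simp add: subgame_profiles_def)
    ultimately have a: "a \<in> A"
      unfolding a_def subgame_strategies_def by (rule PiE_mem[rotated])
    define r1 where "r1 = r(N := a)"
    have eq: "restrict r1 {..m - 1} = restrict r {..m - 1}" if "m \<le> N" for m
      using that by (intro restrict_ext) (auto simp: r1_def)
    have "r1 \<in> {..N} \<rightarrow>\<^sub>E A"
    proof (rule PiE_I)
      fix x assume "x \<in> {..N}"
      then show "r1 x \<in> A" using PiE_mem[OF r(1), of x] a by (cases "x = N") (simp_all add: r1_def)
    next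
      fix x assume "x \<notin> {..N}"
      then show "r1 x = undefined" using PiE_arb[OF r(1), of x] by (simp add: r1_def)
    qed
    moreover have "restrict r1 {..n - 1} = q" using eq[of n] N r(2) by simp
    moreover have "r1 m = t (active m) (position_along r1 m)" if "m \<in> {n..N}" for m
    proof (cases "m = N")
      case True
      have "position_along r1 N = (N, r)"
        using eq[of N] PiE_restrict[OF r(1)] by (simp add: position_along_def)
      then show ?thesis by (simp add: True r1_def a_def)
    next
      case False
      have "position_along r1 m = position_along r m"
        using that eq[of m] by (simp add: position_along_def)
      then show ?thesis using that False r(3)[of m] by (simp add: r1_def)
    qed
    moreover have "n + int (Suc k) - 1 = N" by (simp add: N_def)
    ultimately show ?case by (metis (no_types, lifting))
  qed
  moreover have "n + int (nat (1 - n)) = 1" using n by simp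
  ultimately have "\<exists>r. r \<in> {..1 - 1} \<rightarrow>\<^sub>E A \<and> restrict r {..n - 1} = q \<and>
          (\<forall>m\<in>{n..1 - 1}. r m = t (active m) (position_along r m))"
    by (metis order_refl)
  then obtain r where "r \<in> {..0} \<rightarrow>\<^sub>E A" "restrict r {..n - 1} = q"
      "\<forall>m\<in>{n..0}. r m = t (active m) (position_along r m)"
    unfolding diff_self by blast
  then show ?thesis
    by (intro exI[of _ r]) (simp add: subgame_play_def runs_def p position_along_def)
qed

lemma subgame_play_outcome:
  assumes "p \<in> positions A" "t \<in> subgame_profiles A p"
  shows "subgame_play A p t (subgame_outcome A p t)"
  unfolding subgame_outcome_def
  using subgame_play_exists[OF assms] subgame_play_unique by (metis theI)

end

theory Submission imports Defs begin

text \<open>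
  Call an action of a player a blunder in the run \<open>r\<close> if it is 1 and the player plays 1 infinitely
  often in \<open>r\<close>, or it is 0 and the player plays 1 only finitely often. Which action is a
  blunder depends only on the tail of \<open>r\<close> at minus infinity, and both players blunder infinitely
  often in every run. Let the player who makes the last blunder lose. The loser of \<open>r\<close> could have
  won by never blundering again after an earlier blunder of the opponent, so no run is
  played in equilibrium.
\<close>

section \<open>Play in subgames\<close>

lemma position_along_in_positions:
  "r \<in> runs A \<Longrightarrow> n \<le> 0 \<Longrightarrow> position_along r n \<in> positions A"
  by (auto simp: position_along_def positions_def runs_def PiE_iff)

lemma position_along_eq_iff:
  "position_along r n = position_along r' n \<longleftrightarrow> (\<forall>m<n. r m = r' m)"
proof
  assume "position_along r n = position_along r' n"
  then have *: "restrict r {..n - 1} = restrict r' {..n - 1}"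
    by (simp add: position_along_def)
  show "\<forall>m<n. r m = r' m"
  proof (intro allI impI)
    fix m assume "m < n"
    then show "r m = r' m" using fun_cong[OF *, of m] by simp
  qed
next
  assume "\<forall>m<n. r m = r' m"
  then show "position_along r n = position_along r' n"
    by (auto simp: position_along_def restrict_def)
qed

text \<open>Induced profiles and subgame strategies are restricted functions, equal to
  \<open>undefined\<close> off their domain. This membership is what allows evaluating them along a
  run.\<close>

lemma position_along_in_subgame:
  assumes "r \<in> runs A" "n \<le> m" "m \<le> 0"
  shows "position_along r m \<in> controlled A (active m) \<inter> subgame_positions A (position_along r n)"
proof -
  have "restrict (restrict r {..m - 1}) {..n - 1} = restrict r {..n - 1}"
    using assms(2) by (auto simp: restrict_def)
  then show ?thesis
    using position_along_in_positions[OF assms(1,3)] assms(2)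
    by (simp add: controlled_def subgame_positions_def position_along_def)
qed

lemma induced_profile_in_subgame_profiles:
  assumes "s \<in> profiles A"
  shows "induced_profile A s p \<in> subgame_profiles A p"
proof -
  have "s i q \<in> A" if "q \<in> controlled A i" for i q
    using assms that by (auto simp: profiles_def strategies_def PiE_iff)
  then show ?thesis
    by (auto simp: induced_profile_def subgame_profiles_def subgame_strategies_def)
qed

lemma subgame_outcome_induced_profile:
  assumes "r \<in> consistent_runs A s" "n \<le> 0"
  shows "subgame_outcome A (position_along r n) (induced_profile A s (position_along r n)) = r"
proof -
  have r: "r \<in> runs A" and c: "\<And>m. m \<le> 0 \<Longrightarrow> r m = s (active m) (position_along r m)"
    using assms(1) by (auto simp: consistent_runs_def consistent_with_def)
  have "subgame_play A (position_along r n) (induced_profile A s (position_along r n)) r"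
    unfolding subgame_play_def
  proof (intro conjI ballI)
    fix m assume "m \<in> {fst (position_along r n)..0}"
    then have m: "n \<le> m" "m \<le> 0" by (auto simp: position_along_def)
    show "r m = induced_profile A s (position_along r n) (active m) (position_along r m)"
      using position_along_in_subgame[OF r m] c[OF m(2)] by (simp add: induced_profile_def)
  qed (use r in \<open>auto simp: position_along_def\<close>)
  then show ?thesis
    unfolding subgame_outcome_def by (blast intro: the_equality subgame_play_unique)
qed

text \<open>Makes the definite description in \<open>subgame_outcome\<close> usable: after a
  unilateral deviation the outcome obeys the deviating profile from stage \<open>n\<close>
  on.\<close>

lemma subgame_play_deviation:
  assumes "s \<in> profiles A" "r \<in> consistent_runs A s" "n \<le> 0"
    and "t' \<in> subgame_strategies A (position_along r n) i"
  shows "subgame_play A (position_along r n) ((induced_profile A s (position_along r n))(i := t'))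
    (subgame_outcome A (position_along r n) ((induced_profile A s (position_along r n))(i := t')))"
proof (rule subgame_play_outcome)
  show "position_along r n \<in> positions A"
    using assms(2,3) by (auto simp: consistent_runs_def intro: position_along_in_positions)
  show "(induced_profile A s (position_along r n))(i := t')
      \<in> subgame_profiles A (position_along r n)"
    using induced_profile_in_subgame_profiles[OF assms(1)] assms(4)
    by (simp add: subgame_profiles_def)
qed

text \<open>Every deviation in a subgame along \<open>r\<close> extends to a deviation in the whole
  game, so optimality of \<open>r\<close> against global deviations yields optimality in each of
  these subgames.\<close>

lemma strong_equilibrium_imp_equilibrium:
  assumes "strong_equilibrium A W s"
  shows "\<exists>r. equilibrium A W s r"
proof -
  obtain r where s: "s \<in> profiles A" and r: "consistent_runs A s = {r}"
    and best: "\<And>i s' r'. s' \<in> strategies A i \<Longrightarrow> r' \<in> consistent_runs A (s(i := s')) \<Longrightarrow>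
        payoff W i r' \<le> payoff W i r"
    using assms by (auto simp: strong_equilibrium_def)
  have rc: "r \<in> consistent_runs A s" using r by simp
  have c: "\<And>m. m \<le> 0 \<Longrightarrow> r m = s (active m) (position_along r m)"
    using rc by (auto simp: consistent_runs_def consistent_with_def)
  have "payoff W i (subgame_outcome A p ((induced_profile A s p)(i := t')))
      \<le> payoff W i (subgame_outcome A p (induced_profile A s p))"
    if n: "n \<le> 0" and p: "p = position_along r n" and t': "t' \<in> subgame_strategies A p i"
    for n i p t'
  proof -
    let ?t = "(induced_profile A s p)(i := t')"
    let ?C = "\<lambda>i. controlled A i \<inter> subgame_positions A p"
    define r' where "r' = subgame_outcome A p ?t"
    \<comment> \<open>The global deviation follows \<open>t'\<close> inside the subgame and
      \<open>s i\<close> everywhere else.\<close>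
    define s' where "s' = (\<lambda>q. if q \<in> ?C i then t' q else s i q)"
    have "subgame_play A p ?t r'"
      using subgame_play_deviation[OF s rc n] t' by (simp add: p r'_def)
    then have r': "r' \<in> runs A" "position_along r' n = position_along r n"
      "\<And>m. n \<le> m \<Longrightarrow> m \<le> 0 \<Longrightarrow> r' m = ?t (active m) (position_along r' m)"
      by (auto simp: subgame_play_def p position_along_def)
    have "s' \<in> strategies A i"
      using s t' by (auto simp: s'_def strategies_def subgame_strategies_def profiles_def PiE_iff
          extensional_def)
    moreover have "r' m = (s(i := s')) (active m) (position_along r' m)" if m: "m \<le> 0" for m
    proof (cases "n \<le> m")
      case True
      have "position_along r' m \<in> ?C (active m)"
        using position_along_in_subgame[OF r'(1) True m] by (simp add: r'(2) p)
      then show ?thesis using r'(3)[OF True m] by (auto simp: s'_def induced_profile_def)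
    next
      case False
      then have "r' m = r m" "position_along r' m = position_along r m"
        using r'(2) by (auto simp: position_along_eq_iff)
      \<comment> \<open>Before stage \<open>n\<close> the positions are too early to belong to the
        subgame, so \<open>s'\<close> copies \<open>s i\<close> there and consistency of
        \<open>r\<close> carries over to \<open>r'\<close>.\<close>
      moreover have "position_along r m \<notin> subgame_positions A p"
        using False by (simp add: p subgame_positions_def position_along_def)
      ultimately show ?thesis using c[OF m] by (simp add: s'_def)
    qed
    then have "r' \<in> consistent_runs A (s(i := s'))"
      using r'(1) by (auto simp: consistent_runs_def consistent_with_def)
    ultimately have "payoff W i r' \<le> payoff W i r" by (rule best)
    then show ?thesis
      using subgame_outcome_induced_profile[OF rc n] by (simp add: p r'_def)
  qed
  then have "equilibrium A W s r"
    using s rc induced_profile_in_subgame_profiles[OF s]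
    by (simp add: equilibrium_def traditional_equilibrium_def)
  then show ?thesis by blast
qed

section \<open>Blunders\<close>

text \<open>Infinitely often means at arbitrarily early stages. The bound \<open>N \<le> 0\<close>
  keeps to stages at which a run has an action.\<close>

definition plays_one_often :: "player \<Rightarrow> nat run \<Rightarrow> bool" where
  "plays_one_often i r \<longleftrightarrow> (\<forall>N\<le>0. \<exists>n<N. active n = i \<and> r n = 1)"

definition blunder :: "nat run \<Rightarrow> player \<Rightarrow> nat" where
  "blunder r i = (if plays_one_often i r then 1 else 0)"

text \<open>With \<open>b\<close> as a parameter in place of \<open>blunder r\<close>, the condition
  involves only finitely many coordinates of \<open>r\<close>; the dependence of \<open>b\<close> on
  the infinite past is treated separately.\<close>

definition last_blunder :: "(player \<Rightarrow> nat) \<Rightarrow> nat run \<Rightarrow> int \<Rightarrow> bool" where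
  "last_blunder b r n \<longleftrightarrow> n \<le> 0 \<and> r n = b (active n) \<and> (\<forall>k\<in>{n<..0}. r k \<noteq> b (active k))"

text \<open>\<open>lost_runs Player2\<close> serves as the winning set of player 1.\<close>

definition lost_runs :: "player \<Rightarrow> nat run set" where
  "lost_runs i = {r \<in> runs {0, 1}. \<exists>n. active n = i \<and> last_blunder (blunder r) r n}"

lemma finite_player: "finite (UNIV :: player set)"
proof (rule finite_subset)
  show "UNIV \<subseteq> {Player1, Player2}" using player.exhaust by blast
qed simp

lemma ex_active_below: "\<exists>n<N. active n = i"
proof (cases "active (N - 1) = i")
  case True
  then show ?thesis by (intro exI[of _ "N - 1"]) simp
next
  case False
  then have "active (N - 2) = i" by (cases i) (auto simp: active_def split: if_splits)
  then show ?thesis by (intro exI[of _ "N - 2"]) simp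
qed

text \<open>A tail property: a witness for the bound \<open>min N n\<close> lies before stage
  \<open>n\<close>, where the runs agree. Hence later deviations cannot change which actions are
  blunders.\<close>

lemma plays_one_often_cong:
  assumes "n \<le> 0" "\<And>m. m < n \<Longrightarrow> r m = r' m"
  shows "plays_one_often i r = plays_one_often i r'"
proof -
  have "plays_one_often i r'" if often: "plays_one_often i r" and eq: "\<And>m. m < n \<Longrightarrow> r m = r' m" for r r'
    unfolding plays_one_often_def
  proof (intro allI impI)
    fix N :: int assume "N \<le> 0"
    then have "min N n \<le> 0" by simp
    then obtain m where "m < min N n" "active m = i" "r m = 1"
      using often unfolding plays_one_often_def by blast
    then show "\<exists>m<N. active m = i \<and> r' m = 1" using eq by (intro exI[of _ m]) auto
  qed
  then show ?thesis using assms(2) by metis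
qed

text \<open>If 1 recurs infinitely often it is the blunder itself; otherwise all sufficiently early
  actions of the player are 0, and then 0 is the blunder.\<close>

lemma ex_blunder_below:
  assumes "r \<in> runs {0, 1}" "N \<le> 0"
  shows "\<exists>n<N. active n = i \<and> r n = blunder r i"
proof (cases "plays_one_often i r")
  case True
  then show ?thesis using assms(2) by (auto simp: plays_one_often_def blunder_def)
next
  case False
  then obtain N' where N': "N' \<le> 0" "\<forall>n<N'. active n = i \<longrightarrow> r n \<noteq> 1"
    by (auto simp: plays_one_often_def)
  obtain n where n: "n < min N N'" "active n = i" using ex_active_below by blast
  have "r n \<in> {0, 1}" using assms(1) n(1) N'(1) by (auto simp: runs_def PiE_iff)
  then show ?thesis using n N' False by (intro exI[of _ n]) (auto simp: blunder_def)
qed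

lemma last_blunder_unique:
  assumes "last_blunder b r n" "last_blunder b r n'"
  shows "n = n'"
  using assms by (cases n n' rule: linorder_cases) (auto simp: last_blunder_def)

text \<open>Blunders occur at infinitely many stages, so the maximum is taken over the finite window
  \<open>B m\<close> from one known blunder up to stage 0.\<close>

lemma ex_last_blunder:
  assumes "r \<in> runs {0, 1}"
  shows "\<exists>n. last_blunder (blunder r) r n"
proof -
  define B where "B m = {n \<in> {m..0}. r n = blunder r (active n)}" for m
  obtain m where m: "m < 0" "r m = blunder r (active m)"
    using ex_blunder_below[OF assms, of 0 Player1] by auto
  have fin: "finite (B m)" by (rule finite_subset[of _ "{m..0}"]) (auto simp: B_def)
  have "m \<in> B m" using m by (simp add: B_def)
  then have ne: "B m \<noteq> {}" by blast
  have "last_blunder (blunder r) r (Max (B m))"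
    unfolding last_blunder_def
  proof (intro conjI ballI notI)
    show "Max (B m) \<le> 0" "r (Max (B m)) = blunder r (active (Max (B m)))"
      using Max_in[OF fin ne] by (auto simp: B_def)
    fix k assume k: "k \<in> {Max (B m)<..0}" "r k = blunder r (active k)"
    then have "k \<in> B m" using Max_in[OF fin ne] by (auto simp: B_def)
    then show False using Max_ge[OF fin] k(1) by fastforce
  qed
  then show ?thesis ..
qed

text \<open>The last blunder exists, is unique and belongs to exactly one player, so every run has
  exactly one loser.\<close>

lemma lost_runs_complement: "runs {0, 1} - lost_runs Player2 = lost_runs Player1"
proof -
  have "r \<in> lost_runs Player1 \<longleftrightarrow> r \<notin> lost_runs Player2" if r: "r \<in> runs {0, 1}" for r
  proof -
    obtain n where n: "last_blunder (blunder r) r n" using ex_last_blunder[OF r] by blast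
    then have "m = n" if "last_blunder (blunder r) r m" for m
      using that by (blast intro: last_blunder_unique)
    then have "r \<in> lost_runs i \<longleftrightarrow> active n = i" for i
      using r n unfolding lost_runs_def by blast
    then show ?thesis by (cases "active n") auto
  qed
  then show ?thesis by (auto simp: lost_runs_def)
qed

lemma payoff_lost_runs:
  "r \<in> runs {0, 1} \<Longrightarrow> payoff (lost_runs Player2) i r = (if r \<in> lost_runs i then 0 else 1)"
  using lost_runs_complement by (cases i) auto

section \<open>A profitable deviation for the loser of any run\<close>

lemma no_equilibrium: "\<not> equilibrium {0, 1} (lost_runs Player2) s r"
proof
  assume eq: "equilibrium {0, 1} (lost_runs Player2) s r"
  let ?A = "{0, 1 :: nat}"
  have s: "s \<in> profiles ?A" and rc: "r \<in> consistent_runs ?A s"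
    and nash: "\<And>n i t'. n \<le> 0 \<Longrightarrow> t' \<in> subgame_strategies ?A (position_along r n) i \<Longrightarrow>
      payoff (lost_runs Player2) i (subgame_outcome ?A (position_along r n)
          ((induced_profile ?A s (position_along r n))(i := t')))
      \<le> payoff (lost_runs Player2) i (subgame_outcome ?A (position_along r n)
          (induced_profile ?A s (position_along r n)))"
    using eq by (auto simp: equilibrium_def traditional_equilibrium_def)
  have r: "r \<in> runs ?A" using rc by (simp add: consistent_runs_def)
  obtain i where i: "r \<in> lost_runs i"
    using ex_last_blunder[OF r] r by (auto simp: lost_runs_def)
  obtain j where j: "j \<noteq> i" by (metis player.distinct(1))
  \<comment> \<open>The opponent \<open>j\<close> of the loser \<open>i\<close> has blundered before
    stage 0, so stage \<open>n + 1\<close> is still part of the game.\<close>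
  obtain n where n: "n < 0" "active n = j" "r n = blunder r j"
    using ex_blunder_below[OF r] by (metis order_refl)
  then have n1: "n + 1 \<le> 0" by simp
  \<comment> \<open>The subgame starts just after this blunder, which therefore stays in the history
    under any deviation.\<close>
  define p where "p = position_along r (n + 1)"
  \<comment> \<open>The loser plays the other action at every later stage: on \<open>{0, 1}\<close>
    this is \<open>1 - blunder r i\<close>.\<close>
  define t' where
    "t' = restrict (\<lambda>_. 1 - blunder r i) (controlled ?A i \<inter> subgame_positions ?A p)"
  have t': "t' \<in> subgame_strategies ?A p i"
    by (auto simp: t'_def subgame_strategies_def blunder_def)
  define r' where "r' = subgame_outcome ?A p ((induced_profile ?A s p)(i := t'))"
  have "subgame_play ?A p ((induced_profile ?A s p)(i := t')) r'"
    using subgame_play_deviation[OF s rc n1] t' by (simp add: p_def r'_def)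
  then have r': "r' \<in> runs ?A" "position_along r' (n + 1) = p"
      "\<And>m. n + 1 \<le> m \<Longrightarrow> m \<le> 0 \<Longrightarrow>
        r' m = ((induced_profile ?A s p)(i := t')) (active m) (position_along r' m)"
    by (auto simp: subgame_play_def p_def position_along_def)
  have same: "r' m = r m" if "m \<le> n" for m
    using r'(2) that by (auto simp: p_def position_along_eq_iff)
  \<comment> \<open>The two runs share their past, so \<open>t'\<close> avoids the blunder of
    \<open>i\<close> in \<open>r'\<close> as well.\<close>
  have b: "blunder r' = blunder r"
    using plays_one_often_cong[of n r' r] same n(1) by (auto simp: blunder_def)
  have "r' \<notin> lost_runs i"
  proof
    assume "r' \<in> lost_runs i"
    then obtain k where k: "active k = i" "k \<le> 0" "r' k = blunder r i"
      and last: "\<forall>m\<in>{k<..0}. r' m \<noteq> blunder r (active m)"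
      by (auto simp: lost_runs_def last_blunder_def b)
    \<comment> \<open>The stage \<open>k\<close> of the last blunder is not below \<open>n\<close>,
      where \<open>j\<close> blunders later, and is not \<open>n\<close>, where \<open>j\<close> is
      active. So it falls in the subgame, where \<open>t'\<close> never blunders.\<close>
    have "n \<notin> {k<..0}" using last n same[of n] by auto
    moreover have "k \<noteq> n" using n(2) k(1) j by auto
    ultimately have "n + 1 \<le> k" using n(1) by auto
    then have "r' k = 1 - blunder r i"
      using r'(3)[of k] position_along_in_subgame[OF r'(1), of "n + 1" k] k
      by (simp add: r'(2) t'_def)
    then show False using k(3) by (auto simp: blunder_def split: if_splits)
  qed
  moreover have "payoff (lost_runs Player2) i r' \<le> payoff (lost_runs Player2) i r"
    using nash[OF n1, of t' i] t' subgame_outcome_induced_profile[OF rc n1]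
    by (simp add: p_def r'_def)
  ultimately show False
    using i by (simp add: payoff_lost_runs[OF r] payoff_lost_runs[OF r'(1)])
qed

section \<open>Borel complexity\<close>

text \<open>Links the library's G-delta sets to level 2 of the hierarchy: the complement is F-sigma,
  hence a countable union of closed sets.\<close>

lemma gdelta_in_imp_borel_Pi:
  assumes "gdelta_in X S"
  shows "S \<in> borel_Pi X (Suc (Suc 0))"
proof -
  have "fsigma_in X (topspace X - S)" and sub: "S \<subseteq> topspace X"
    using assms by (auto simp: gdelta_in_fsigma_in)
  then obtain \<C> where "countable \<C>" "\<C> \<subseteq> Collect (closedin X)" "\<Union>\<C> = topspace X - S"
    by (auto simp: fsigma_in_def union_of_def)
  then have "topspace X - S \<in> borel_Sigma X (Suc (Suc 0))"
    by (auto intro!: exI[of _ \<C>])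
  moreover have "S = topspace X - (topspace X - S)" using sub by auto
  ultimately show ?thesis by (simp del: borel_Sigma.simps) blast
qed

lemma countable_Union_gdelta_in_borel_Sigma:
  assumes "countable I" "\<And>i. i \<in> I \<Longrightarrow> gdelta_in X (S i)"
  shows "(\<Union>i\<in>I. S i) \<in> borel_Sigma X 3"
proof -
  have "S ` I \<subseteq> borel_Pi X (Suc (Suc 0))"
    using assms(2) gdelta_in_imp_borel_Pi by blast
  then have "(\<Union>i\<in>I. S i) \<in> borel_Sigma X (Suc (Suc (Suc 0)))"
    using assms(1) unfolding borel_Sigma.simps by blast
  then show ?thesis by (simp only: numeral_3_eq_3)
qed

lemma gdelta_in_ball:
  assumes "countable I" "\<And>i. i \<in> I \<Longrightarrow> gdelta_in X {x \<in> topspace X. P i x}"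
  shows "gdelta_in X {x \<in> topspace X. \<forall>i\<in>I. P i x}"
proof -
  \<comment> \<open>Inserting \<open>topspace X\<close> covers empty \<open>I\<close>, where the
    bare intersection would be the whole type.\<close>
  have "gdelta_in X (\<Inter>(insert (topspace X) ((\<lambda>i. {x \<in> topspace X. P i x}) ` I)))"
    using assms by (intro gdelta_in_Inter) auto
  moreover have "\<Inter>(insert (topspace X) ((\<lambda>i. {x \<in> topspace X. P i x}) ` I))
      = {x \<in> topspace X. \<forall>i\<in>I. P i x}"
    by auto
  ultimately show ?thesis by metis
qed

lemma gdelta_in_conj:
  assumes "gdelta_in X {x \<in> topspace X. P x}" "gdelta_in X {x \<in> topspace X. Q x}"
  shows "gdelta_in X {x \<in> topspace X. P x \<and> Q x}"
proof -
  have "{x \<in> topspace X. P x \<and> Q x} = {x \<in> topspace X. P x} \<inter> {x \<in> topspace X. Q x}"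
    by auto
  then show ?thesis using gdelta_in_Int[OF assms] by simp
qed

section \<open>Complexity of the blunder conditions\<close>

lemma openin_run_coordinate:
  assumes "n \<le> 0"
  shows "openin (run_topology A) {r \<in> topspace (run_topology A). P (r n)}"
proof -
  have "continuous_map (run_topology A) (discrete_topology A) (\<lambda>r. r n)"
    unfolding run_topology_def by (rule continuous_map_product_projection) (use assms in simp)
  \<comment> \<open>Every subset of \<open>A\<close> is open in the discrete topology, so any
    predicate on one coordinate gives an open set.\<close>
  then have "openin (run_topology A) {r \<in> topspace (run_topology A). r n \<in> {a \<in> A. P a}}"
    by (rule openin_continuous_map_preimage) auto
  moreover have "r n \<in> A" if "r \<in> topspace (run_topology A)" for r
    using that assms by (auto simp: topspace_run_topology runs_def PiE_iff)
  then have "{r \<in> topspace (run_topology A). r n \<in> {a \<in> A. P a}}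
      = {r \<in> topspace (run_topology A). P (r n)}"
    by auto
  ultimately show ?thesis by simp
qed

text \<open>Playing 1 only finitely often is an F-sigma condition. Fixing a bound \<open>N\<close>
  below which no 1 occurs makes it closed, so that the whole condition becomes G-delta.\<close>

definition blunder_witness :: "(player \<Rightarrow> nat) \<Rightarrow> int \<Rightarrow> nat run \<Rightarrow> bool" where
  "blunder_witness b N r \<longleftrightarrow>
     (\<forall>i. if b i = 1 then plays_one_often i r else \<forall>n<N. active n = i \<longrightarrow> r n \<noteq> 1)"

lemma blunder_witness_imp_eq:
  assumes "blunder_witness b N r" "N \<le> 0" "range b \<subseteq> {0, 1}"
  shows "blunder r = b"
proof
  fix i
  show "blunder r i = b i"
  proof (cases "b i = 1")
    case True
    then show ?thesis using assms(1) by (auto simp: blunder_witness_def blunder_def)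
  next
    case False
    then have "\<not> plays_one_often i r"
      using assms(1,2) unfolding blunder_witness_def plays_one_often_def by metis
    moreover have "b i = 0" using False assms(3) by auto
    ultimately show ?thesis by (simp add: blunder_def)
  qed
qed

lemma ex_blunder_witness: "\<exists>N\<le>0. blunder_witness (blunder r) N r"
proof -
  have "\<exists>N\<le>0. \<not> plays_one_often i r \<longrightarrow> (\<forall>n<N. active n = i \<longrightarrow> r n \<noteq> 1)" for i
    unfolding plays_one_often_def by blast
  then obtain N where N: "\<And>i. N i \<le> 0"
      "\<And>i n. \<not> plays_one_often i r \<Longrightarrow> n < N i \<Longrightarrow> active n = i \<Longrightarrow> r n \<noteq> 1"
    by metis
  \<comment> \<open>One bound has to serve both players, and lowering a bound preserves its
    property.\<close>
  define M where "M = min (N Player1) (N Player2)"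
  have "M \<le> N i" for i by (cases i) (auto simp: M_def)
  then have "blunder_witness (blunder r) M r"
    using N(2) unfolding blunder_witness_def blunder_def by (auto dest: order_less_le_trans)
  then show ?thesis using \<open>M \<le> N Player1\<close> N(1)[of Player1] by (intro exI[of _ M]) auto
qed

text \<open>For each \<open>N\<close> a union of open coordinate conditions, then an intersection
  over the countably many \<open>N\<close>.\<close>

lemma gdelta_in_plays_one_often:
  "gdelta_in (run_topology A) {r \<in> topspace (run_topology A). plays_one_often i r}"
proof -
  have "gdelta_in (run_topology A)
      {r \<in> topspace (run_topology A). \<exists>n<N. active n = i \<and> r n = 1}" if "N \<le> 0" for N
  proof (rule open_imp_gdelta_in)
    have "openin (run_topology A)
        (\<Union>n\<in>{n. n < N \<and> active n = i}. {r \<in> topspace (run_topology A). r n = 1})"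
      using that by (intro openin_Union) (auto intro!: openin_run_coordinate)
    moreover have "(\<Union>n\<in>{n. n < N \<and> active n = i}. {r \<in> topspace (run_topology A). r n = 1})
        = {r \<in> topspace (run_topology A). \<exists>n<N. active n = i \<and> r n = 1}"
      by auto
    ultimately show "openin (run_topology A)
        {r \<in> topspace (run_topology A). \<exists>n<N. active n = i \<and> r n = 1}"
      by simp
  qed
  then have "gdelta_in (run_topology A)
      {r \<in> topspace (run_topology A). \<forall>N\<in>{..0}. \<exists>n<N. active n = i \<and> r n = 1}"
    by (intro gdelta_in_ball) auto
  moreover have "plays_one_often i r \<longleftrightarrow> (\<forall>N\<in>{..0}. \<exists>n<N. active n = i \<and> r n = 1)" for r
    by (simp only: plays_one_often_def Ball_def atMost_iff)
  ultimately show ?thesis by simp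
qed

lemma gdelta_in_blunder_witness:
  assumes "N \<le> 0"
  shows "gdelta_in (run_topology A) {r \<in> topspace (run_topology A). blunder_witness b N r}"
proof -
  let ?X = "run_topology A"
  have single: "gdelta_in ?X {r \<in> topspace ?X.
      if b i = 1 then plays_one_often i r else \<forall>n<N. active n = i \<longrightarrow> r n \<noteq> 1}" for i
  proof (cases "b i = 1")
    case True
    then show ?thesis by (simp add: gdelta_in_plays_one_often)
  next
    case False
    have "gdelta_in ?X {r \<in> topspace ?X. \<forall>n\<in>{n. n < N \<and> active n = i}. r n \<noteq> 1}"
      using assms by (intro gdelta_in_ball open_imp_gdelta_in openin_run_coordinate) auto
    then show ?thesis using False by (simp add: imp_conjL)
  qed
  have "gdelta_in ?X {r \<in> topspace ?X. \<forall>i\<in>UNIV.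
      if b i = 1 then plays_one_often i r else \<forall>n<N. active n = i \<longrightarrow> r n \<noteq> 1}"
    by (rule gdelta_in_ball[OF countable_finite[OF finite_player]]) (rule single)
  then show ?thesis by (simp add: blunder_witness_def)
qed

lemma gdelta_in_last_blunder:
  "gdelta_in (run_topology A) {r \<in> topspace (run_topology A). last_blunder b r n}"
proof (cases "n \<le> 0")
  case True
  have "gdelta_in (run_topology A) {r \<in> topspace (run_topology A).
      r n = b (active n) \<and> (\<forall>k\<in>{n<..0}. r k \<noteq> b (active k))}"
    using True
    by (intro gdelta_in_conj gdelta_in_ball open_imp_gdelta_in openin_run_coordinate) auto
  then show ?thesis using True by (simp add: last_blunder_def)
\<comment> \<open>For \<open>n > 0\<close> the set is empty.\<close>
qed (simp add: last_blunder_def)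

text \<open>A run is lost by \<open>i\<close> iff some blunder assignment \<open>b\<close>, bound
  \<open>N\<close> and stage \<open>n\<close> of \<open>i\<close> certify it. There are finitely
  many \<open>b\<close> and countably many \<open>N\<close> and \<open>n\<close>, and each
  certificate is a G-delta condition.\<close>

lemma lost_runs_in_borel_Sigma: "lost_runs i \<in> borel_Sigma (run_topology {0, 1}) 3"
proof -
  let ?X = "run_topology {0, 1 :: nat}"
  let ?I = "((UNIV :: player set) \<rightarrow>\<^sub>E {0, 1 :: nat}) \<times> {..0 :: int} \<times> {n. active n = i}"
  let ?S = "\<lambda>(b, N, n). {r \<in> topspace ?X. blunder_witness b N r \<and> last_blunder b r n}"
  have "finite ((UNIV :: player set) \<rightarrow>\<^sub>E {0, 1 :: nat})"
    by (intro finite_PiE finite_player) auto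
  then have "countable ?I"
    by (intro countable_SIGMA) (auto intro: countable_finite)
  moreover have "gdelta_in ?X (?S x)" if "x \<in> ?I" for x
    using that by (auto intro!: gdelta_in_conj gdelta_in_blunder_witness gdelta_in_last_blunder)
  ultimately have "(\<Union>x\<in>?I. ?S x) \<in> borel_Sigma ?X 3"
    by (rule countable_Union_gdelta_in_borel_Sigma)
  moreover have "(\<Union>x\<in>?I. ?S x) = lost_runs i"
  proof (intro equalityI subsetI)
    fix r assume "r \<in> (\<Union>x\<in>?I. ?S x)"
    then obtain b N n where *: "range b \<subseteq> {0, 1}" "N \<le> 0" "active n = i" "r \<in> runs {0, 1}"
        "blunder_witness b N r" "last_blunder b r n"
      by (auto simp: topspace_run_topology PiE_iff)
    then show "r \<in> lost_runs i"
      using blunder_witness_imp_eq[OF *(5,2,1)] by (auto simp: lost_runs_def)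
  next
    fix r assume "r \<in> lost_runs i"
    then obtain n where n: "r \<in> runs {0, 1}" "active n = i" "last_blunder (blunder r) r n"
      by (auto simp: lost_runs_def)
    obtain N where N: "N \<le> 0" "blunder_witness (blunder r) N r"
      using ex_blunder_witness by blast
    show "r \<in> (\<Union>x\<in>?I. ?S x)"
      using n N by (intro UN_I[of "(blunder r, N, n)"])
        (auto simp: topspace_run_topology blunder_def split: if_splits)
  qed
  ultimately show ?thesis by simp
qed

text \<open>The losing sets of both players are \<Sigma>3 and complement each other, so both are
  also \<Pi>3.\<close>

lemma lost_runs_in_borel_Delta: "lost_runs Player2 \<in> borel_Delta (run_topology {0, 1}) 3"
proof -
  have "lost_runs Player2 = runs {0, 1} - lost_runs Player1"
    using lost_runs_complement by (auto simp: lost_runs_def)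
  then have "lost_runs Player2 \<in> borel_Pi (run_topology {0, 1}) 3"
    using lost_runs_in_borel_Sigma[of Player1]
    unfolding numeral_3_eq_3 borel_Pi.simps topspace_run_topology by blast
  then show ?thesis using lost_runs_in_borel_Sigma by (simp add: borel_Delta_def)
qed

theorem mainTheorem4:
  "\<exists>W. win_lose_game {0, 1 :: nat} W \<and>
       W \<in> borel_Delta (run_topology {0, 1}) 3 \<and>
       \<not> (\<exists>s r. equilibrium {0, 1} W s r) \<and>
       \<not> (\<exists>s. strong_equilibrium {0, 1} W s)"
proof (intro exI[of _ "lost_runs Player2"] conjI)
  show "win_lose_game {0, 1} (lost_runs Player2)"
    by (auto simp: win_lose_game_def lost_runs_def)
  show "lost_runs Player2 \<in> borel_Delta (run_topology {0, 1}) 3"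
    by (rule lost_runs_in_borel_Delta)
  show "\<not> (\<exists>s r. equilibrium {0, 1} (lost_runs Player2) s r)"
    using no_equilibrium by blast
  then show "\<not> (\<exists>s. strong_equilibrium {0, 1} (lost_runs Player2) s)"
    using strong_equilibrium_imp_equilibrium by blast
qed

end
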